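(* A nondeterministic $\mathrm{Sup}$ automaton $\mathcal A$ on infinite words is history-deterministic if and only if Eve wins the two-token game $G_2(\mathcal A)$.
   Context: **Automata.** A (nondeterministic quantitative) automaton is a tuple $\mathcal A=(\Sigma,Q,\iota,\delta)$ with $\Sigma$ a finite nonempty alphabet, $Q$ a finite nonempty set of states, $\iota\in Q$ the initial state, and $\delta:Q\times\Sigma\to 2^{\mathbb Q\times Q}$ a transition function whose values are finite and nonempty (the automaton is total). If $(x,q')\in\delta(q,\sigma)$ we write $q\xrightarrow{\sigma:x}q'$ for this transition, of weight $x$. A run on an infinite word $w=\sigma_0\sigma_1\ldots$ is a sequence of transitions $q_0\xrightarrow{\sigma_0:x_0}q_1\xrightarrow{\sigma_1:x_1}\ldots$ with $q_0=\iota$. A $\mathrm{Sup}$ automaton has the value function $\mathrm{Val}=\mathrm{Sup}$, $\mathrm{Sup}(v_0v_1\ldots)=\sup\{v_n\mid n\ge0\}$. The value $\mathrm{Val}(\rho)$ of a run $\rho$ is the value function applied to its weight sequence, and $\mathcal A(w)$ is the supremum of the values of all runs of $\mathcal A$ on $w$. **Letter game and history-determinism.** A play of the letter game on $\mathcal A$ starts in $q_0=\iota$; in turn $i=0,1,\ldots$, from state $q_i$, Adam picks a letter $\sigma_i\in\Sigma$ and then Eve picks a transition $t_i=q_i\xrightarrow{\sigma_i:x_i}q_{i+1}$. This yields an infinite word $w=\sigma_0\sigma_1\ldots$ and an infinite sequence $\pi=t_0t_1\ldots$. Eve wins if $\mathrm{Val}(\pi)\ge\mathcal A(w)$. $\mathcal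 A$ is history-deterministic (HD) if Eve has a winning strategy in the letter game. **Token game $G_2(\mathcal A)$.** Configurations are triples $(q,p_1,p_2)\in Q^3$, initially $(\iota,\iota,\iota)$. In each turn, from $(q,p_1,p_2)$: Adam picks a letter $\sigma\in\Sigma$; then Eve picks a transition $q\xrightarrow{\sigma:x}q'$; then Adam picks transitions $p_1\xrightarrow{\sigma:y_1}p_1'$ and $p_2\xrightarrow{\sigma:y_2}p_2'$; the next configuration is $(q',p_1',p_2')$. This yields three infinite runs over the same word, $\pi$ (Eve) and $\pi_1,\pi_2$ (Adam). Eve wins the play if $\mathrm{Val}(\pi)\ge\max(\mathrm{Val}(\pi_1),\mathrm{Val}(\pi_2))$. Eve wins $G_2(\mathcal A)$ if she has a winning strategy. *)

theory Defs
  imports Complex_Main "HOL-Library.Extended_Real"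
begin

record ('q, 'a) automaton =
  alphabet :: "'a set"
  states :: "'q set"
  initial :: "'q"
  delta :: "'q \<Rightarrow> 'a \<Rightarrow> (rat \<times> 'q) set"

definition wf_automaton :: "('q, 'a) automaton \<Rightarrow> bool" where
  "wf_automaton A \<longleftrightarrow>
     finite (alphabet A) \<and> alphabet A \<noteq> {} \<and>
     finite (states A) \<and> initial A \<in> states A \<and>
     (\<forall>q\<in>states A. \<forall>a\<in>alphabet A.
        finite (delta A q a) \<and> delta A q a \<noteq> {} \<and> delta A q a \<subseteq> UNIV \<times> states A)"

datatype ('q, 'a) transition =
  Transition (src: 'q) (letter: 'a) (weight: rat) (tgt: 'q)

definition transitions :: "('q, 'a) automaton \<Rightarrow> ('q, 'a) transition set" where
  "transitions A =
     {t. src t \<in> states A \<and> letter t \<in> alphabet A \<and>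
         (weight t, tgt t) \<in> delta A (src t) (letter t)}"

definition words :: "('q, 'a) automaton \<Rightarrow> (nat \<Rightarrow> 'a) set" where
  "words A = {w. \<forall>n. w n \<in> alphabet A}"

definition is_run ::
  "('q, 'a) automaton \<Rightarrow> (nat \<Rightarrow> 'a) \<Rightarrow> (nat \<Rightarrow> ('q, 'a) transition) \<Rightarrow> bool" where
  "is_run A w \<rho> \<longleftrightarrow>
     src (\<rho> 0) = initial A \<and>
     (\<forall>n. \<rho> n \<in> transitions A \<and> letter (\<rho> n) = w n \<and> tgt (\<rho> n) = src (\<rho> (Suc n)))"

type_synonym value_function = "(nat \<Rightarrow> rat) \<Rightarrow> ereal"

text \<open>Values live in the extended reals, a complete lattice, so that every supremum below is a
  genuine one.\<close>

definition Sup_val :: value_function where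
  "Sup_val v = (SUP n. ereal (of_rat (v n)))"

definition run_value :: "value_function \<Rightarrow> (nat \<Rightarrow> ('q, 'a) transition) \<Rightarrow> ereal" where
  "run_value Val \<rho> = Val (\<lambda>n. weight (\<rho> n))"

definition word_value :: "value_function \<Rightarrow> ('q, 'a) automaton \<Rightarrow> (nat \<Rightarrow> 'a) \<Rightarrow> ereal" where
  "word_value Val A w = (SUP \<rho>\<in>{\<rho>. is_run A w \<rho>}. run_value Val \<rho>)"

text \<open>A strategy for Eve maps the history of the completed turns and Adam's current letter to a
  transition. In both games, a winning strategy must make only legal moves against every legal
  behaviour of Adam: this is the condition below that the sequence \<open>\<pi>\<close> produced by the
  strategy is a run on \<open>w\<close>. As the automaton is total and its alphabet nonempty, every finite
  legal play extends to an infinite one, so considering infinite plays covers all finite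
  histories.\<close>

type_synonym ('q, 'a) letter_strategy =
  "('q, 'a) transition list \<Rightarrow> 'a \<Rightarrow> ('q, 'a) transition"

definition letter_consistent ::
  "('q, 'a) letter_strategy \<Rightarrow> (nat \<Rightarrow> 'a) \<Rightarrow> (nat \<Rightarrow> ('q, 'a) transition) \<Rightarrow> bool" where
  "letter_consistent s w \<pi> \<longleftrightarrow> (\<forall>n. \<pi> n = s (map \<pi> [0..<n]) (w n))"

definition letter_winning ::
  "value_function \<Rightarrow> ('q, 'a) automaton \<Rightarrow> ('q, 'a) letter_strategy \<Rightarrow> bool" where
  "letter_winning Val A s \<longleftrightarrow>
     (\<forall>w\<in>words A. \<forall>\<pi>. letter_consistent s w \<pi> \<longrightarrow>
        is_run A w \<pi> \<and> run_value Val \<pi> \<ge> word_value Val A w)"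

definition history_deterministic :: "value_function \<Rightarrow> ('q, 'a) automaton \<Rightarrow> bool" where
  "history_deterministic Val A \<longleftrightarrow> (\<exists>s. letter_winning Val A s)"

text \<open>In the two-token game, a history lists for each completed turn the transition of Eve and the
  two transitions of Adam. In the current turn Eve sees Adam's letter but not yet his
  transitions.\<close>

type_synonym ('q, 'a) G2_strategy =
  "(('q, 'a) transition \<times> ('q, 'a) transition \<times> ('q, 'a) transition) list
     \<Rightarrow> 'a \<Rightarrow> ('q, 'a) transition"

definition G2_consistent ::
  "('q, 'a) G2_strategy \<Rightarrow> (nat \<Rightarrow> 'a) \<Rightarrow> (nat \<Rightarrow> ('q, 'a) transition)
     \<Rightarrow> (nat \<Rightarrow> ('q, 'a) transition) \<Rightarrow> (nat \<Rightarrow> ('q, 'a) transition) \<Rightarrow> bool" where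
  "G2_consistent s w \<pi> \<pi>1 \<pi>2 \<longleftrightarrow>
     (\<forall>n. \<pi> n = s (map (\<lambda>i. (\<pi> i, \<pi>1 i, \<pi>2 i)) [0..<n]) (w n))"

definition G2_winning ::
  "value_function \<Rightarrow> ('q, 'a) automaton \<Rightarrow> ('q, 'a) G2_strategy \<Rightarrow> bool" where
  "G2_winning Val A s \<longleftrightarrow>
     (\<forall>w\<in>words A. \<forall>\<pi> \<pi>1 \<pi>2.
        is_run A w \<pi>1 \<and> is_run A w \<pi>2 \<and> G2_consistent s w \<pi> \<pi>1 \<pi>2 \<longrightarrow>
        is_run A w \<pi> \<and> run_value Val \<pi> \<ge> max (run_value Val \<pi>1) (run_value Val \<pi>2))"

definition Eve_wins_G2 :: "value_function \<Rightarrow> ('q, 'a) automaton \<Rightarrow> bool" where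
  "Eve_wins_G2 Val A \<longleftrightarrow> (\<exists>s. G2_winning Val A s)"

end

theory Submission
  imports Defs
begin

text \<open>If Eve wins the two-token game, then by composing strategies she wins against any finite family of
  tokens. Let \<open>F\<^sub>m\<close> be the set of states from which Eve can force a weight at least \<open>m\<close> whatever
  letters Adam picks. In a token game won by Eve, as soon as a token has seen a weight at least \<open>m\<close>,
  or is in \<open>F\<^sub>m\<close>, the same holds for Eve, since otherwise Adam could from now on pick letters
  that keep her below \<open>m\<close> forever. In the letter game Eve plays against one token that always copies her
  moves and, for each weight \<open>m\<close>, one token that copies her moves until she enters \<open>F\<^sub>m\<close> and
  then forces a weight at least \<open>m\<close>. Comparing the first token with any run on the current word that
  sees \<open>m\<close>, Eve either sees \<open>m\<close> herself or enters \<open>F\<^sub>m\<close>; in the latter case the token of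
  \<open>m\<close> obliges her to see \<open>m\<close> eventually.\<close>

section \<open>Policies, causal strategies and forcing sets\<close>

definition is_policy :: "('q, 'a) automaton \<Rightarrow> ('q \<Rightarrow> 'a \<Rightarrow> ('q, 'a) transition) \<Rightarrow> bool" where
  "is_policy A p \<longleftrightarrow> (\<forall>q\<in>states A. \<forall>a\<in>alphabet A.
     p q a \<in> transitions A \<and> src (p q a) = q \<and> letter (p q a) = a)"

text \<open>The two bounds encode the order of moves within a turn: Eve's move of turn
  \<open>n\<close> may use letter \<open>n\<close>, but only token moves of earlier turns.\<close>

definition causal ::
  "((nat \<Rightarrow> 'a) \<Rightarrow> ('i \<Rightarrow> nat \<Rightarrow> 't) \<Rightarrow> nat \<Rightarrow> 't) \<Rightarrow> bool" where
  "causal \<Phi> \<longleftrightarrow> (\<forall>w w' T T' n.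
     (\<forall>i\<le>n. w i = w' i) \<longrightarrow> (\<forall>j. \<forall>i<n. T j i = T' j i) \<longrightarrow> \<Phi> w T n = \<Phi> w' T' n)"

lemma causalD:
  assumes "causal \<Phi>" "\<And>i. i \<le> n \<Longrightarrow> w i = w' i" "\<And>j i. i < n \<Longrightarrow> T j i = T' j i"
  shows "\<Phi> w T n = \<Phi> w' T' n"
  using assms unfolding causal_def by blast

text \<open>A strategy of Eve against tokens indexed by \<open>J\<close>, given as the map from the word and the token
  runs to her own run. It makes legal moves even if the tokens do not.\<close>

definition token_winning ::
  "('q, 'a) automaton \<Rightarrow> 'i set \<Rightarrow>
    ((nat \<Rightarrow> 'a) \<Rightarrow> ('i \<Rightarrow> nat \<Rightarrow> ('q, 'a) transition) \<Rightarrow> nat \<Rightarrow> ('q, 'a) transition) \<Rightarrow> bool" where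
  "token_winning A J \<Phi> \<longleftrightarrow> causal \<Phi> \<and> (\<forall>w\<in>words A. \<forall>T.
     is_run A w (\<Phi> w T) \<and>
     ((\<forall>j\<in>J. is_run A w (T j)) \<longrightarrow>
       (\<forall>j\<in>J. run_value Sup_val (T j) \<le> run_value Sup_val (\<Phi> w T))))"

lemma
  assumes "token_winning A J \<Phi>"
  shows token_winning_causal: "causal \<Phi>"
    and token_winning_run: "w \<in> words A \<Longrightarrow> is_run A w (\<Phi> w T)"
    and token_winning_value: "w \<in> words A \<Longrightarrow> (\<And>j. j \<in> J \<Longrightarrow> is_run A w (T j)) \<Longrightarrow> i \<in> J \<Longrightarrow>
      run_value Sup_val (T i) \<le> run_value Sup_val (\<Phi> w T)"
  using assms unfolding token_winning_def by blast+

text \<open>\<open>P n\<close> decides transition \<open>n\<close>, so for monotone \<open>P\<close>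
  the copy of \<open>\<rho>\<close> ends at the first time \<open>P\<close> holds.\<close>

primrec switch ::
  "'q \<Rightarrow> ('q \<Rightarrow> 'a \<Rightarrow> ('q, 'a) transition) \<Rightarrow> (nat \<Rightarrow> bool) \<Rightarrow> (nat \<Rightarrow> ('q, 'a) transition)
    \<Rightarrow> (nat \<Rightarrow> 'a) \<Rightarrow> nat \<Rightarrow> ('q, 'a) transition" where
  "switch q p P \<rho> w 0 = (if P 0 then p q (w 0) else \<rho> 0)"
| "switch q p P \<rho> w (Suc n) =
     (if P (Suc n) then p (tgt (switch q p P \<rho> w n)) (w (Suc n)) else \<rho> (Suc n))"

text \<open>Stages of an attractor: the index bounds the number of turns in which Eve can force
  weight \<open>m\<close>, and serves as a rank that decreases along her forcing moves.\<close>

primrec forcing :: "('q, 'a) automaton \<Rightarrow> rat \<Rightarrow> nat \<Rightarrow> 'q set" where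
  "forcing A m 0 = {}"
| "forcing A m (Suc k) =
     {q \<in> states A. \<forall>a\<in>alphabet A. \<exists>(x, q')\<in>delta A q a. m \<le> x \<or> q' \<in> forcing A m k}"

text \<open>A condition on the position before turn \<open>N\<close>: along a run it depends only on
  the first \<open>N\<close> transitions, and so transfers between runs that agree on them.\<close>

definition reaches :: "('q, 'a) automaton \<Rightarrow> rat \<Rightarrow> (nat \<Rightarrow> ('q, 'a) transition) \<Rightarrow> nat \<Rightarrow> bool" where
  "reaches A m \<rho> N \<longleftrightarrow> (\<exists>i<N. m \<le> weight (\<rho> i)) \<or> src (\<rho> N) \<in> (\<Union>k. forcing A m k)"

section \<open>Recursion along plays and basic facts on runs\<close>

text \<open>Well-founded recursion on time. It resolves the circularity between a play and the moves
  computed from its own past.\<close>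

lemma causal_fixpoint:
  fixes H :: "(nat \<Rightarrow> 'b) \<Rightarrow> nat \<Rightarrow> 'b"
  assumes "\<And>f g n. (\<And>i. i < n \<Longrightarrow> f i = g i) \<Longrightarrow> H f n = H g n"
  shows "\<exists>f. \<forall>n. f n = H f n"
proof -
  have "adm_wf less_than H"
    unfolding adm_wf_def by (auto intro!: assms)
  then have "wfrec less_than H = H (wfrec less_than H)"
    by (intro wfrec_fixpoint wf_less_than)
  then have "wfrec less_than H n = H (wfrec less_than H) n" for n
    by (rule fun_cong)
  then show ?thesis by (intro exI[of _ "wfrec less_than H"] allI)
qed

lemma
  assumes "is_run A w \<rho>"
  shows run_transition: "\<rho> n \<in> transitions A"
    and run_letter: "letter (\<rho> n) = w n"
    and run_initial: "src (\<rho> 0) = initial A"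
    and run_step: "src (\<rho> (Suc n)) = tgt (\<rho> n)"
    and run_src_states: "src (\<rho> n) \<in> states A"
  using assms by (simp_all add: is_run_def) (simp add: transitions_def)

lemma run_src_cong:
  assumes "is_run A w \<rho>" "is_run A w' \<rho>'" "\<And>i. i < N \<Longrightarrow> \<rho> i = \<rho>' i"
  shows "src (\<rho> N) = src (\<rho>' N)"
proof (cases N)
  case 0
  then show ?thesis using run_initial[OF assms(1)] run_initial[OF assms(2)] by simp
next
  case (Suc k)
  then show ?thesis using run_step[OF assms(1), of k] run_step[OF assms(2), of k] assms(3)[of k] by simp
qed

lemma tgt_states:
  assumes "wf_automaton A" "t \<in> transitions A"
  shows "tgt t \<in> states A"
  using assms by (fastforce simp: wf_automaton_def transitions_def)

lemma finite_weights:
  assumes "wf_automaton A"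
  shows "finite (weight ` transitions A)"
proof (rule finite_subset)
  show "weight ` transitions A \<subseteq> (\<Union>q\<in>states A. \<Union>a\<in>alphabet A. fst ` delta A q a)"
    by (force simp: transitions_def)
  show "finite (\<Union>q\<in>states A. \<Union>a\<in>alphabet A. fst ` delta A q a)"
    using assms by (auto simp: wf_automaton_def)
qed

lemma weight_le_run_value: "ereal (of_rat (weight (\<rho> n))) \<le> run_value Sup_val \<rho>"
  unfolding run_value_def Sup_val_def by (rule SUP_upper) auto

text \<open>Only finitely many weights occur in the automaton, so the supremum is attained by some
  transition of the run.\<close>

lemma le_run_value_iff:
  assumes "wf_automaton A" "is_run A w \<rho>"
  shows "ereal (of_rat m) \<le> run_value Sup_val \<rho> \<longleftrightarrow> (\<exists>n. m \<le> weight (\<rho> n))"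
proof
  assume "\<exists>n. m \<le> weight (\<rho> n)"
  then obtain n where "m \<le> weight (\<rho> n)" by auto
  then have "ereal (of_rat m) \<le> ereal (of_rat (weight (\<rho> n)))"
    by (simp add: of_rat_less_eq)
  then show "ereal (of_rat m) \<le> run_value Sup_val \<rho>"
    using weight_le_run_value order_trans by blast
next
  assume le: "ereal (of_rat m) \<le> run_value Sup_val \<rho>"
  let ?X = "range (\<lambda>n. ereal (of_rat (weight (\<rho> n))))"
  have "?X \<subseteq> (\<lambda>x. ereal (of_rat x)) ` weight ` transitions A"
    using run_transition[OF assms(2)] by auto
  then have "finite ?X"
    using finite_weights[OF assms(1)] finite_subset by blast
  then have "Sup ?X \<in> ?X"
    by (metis Max_Sup Max_in UNIV_not_empty image_is_empty)
  then obtain n where "run_value Sup_val \<rho> = ereal (of_rat (weight (\<rho> n)))"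
    by (auto simp: run_value_def Sup_val_def)
  then show "\<exists>n. m \<le> weight (\<rho> n)"
    using le by (auto simp: of_rat_less_eq)
qed

section \<open>Runs that switch to a policy\<close>

lemma switch_cong:
  assumes "\<And>i. i \<le> n \<Longrightarrow> w i = w' i" "\<And>i. i \<le> n \<Longrightarrow> P i = P' i"
    and "\<And>i. i \<le> n \<Longrightarrow> \<not> P i \<Longrightarrow> \<rho> i = \<rho>' i"
  shows "switch q p P \<rho> w n = switch q p P' \<rho>' w' n"
  using assms by (induction n) auto

lemma switch_before: "\<not> P n \<Longrightarrow> switch q p P \<rho> w n = \<rho> n"
  by (cases n) auto

text \<open>The prefix may come from a run on another word \<open>w'\<close> that agrees with
  \<open>w\<close> before the switch; thus a token can keep its past while Adam changes the future
  letters.\<close>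

lemma is_run_switch:
  assumes A: "wf_automaton A" and p: "is_policy A p" and w: "w \<in> words A"
    and P: "\<And>n. P n \<Longrightarrow> P (Suc n)"
    and \<rho>: "\<And>n. \<not> P n \<Longrightarrow> is_run A w' \<rho> \<and> w' n = w n"
  shows "is_run A w (switch (initial A) p P \<rho> w)"
proof -
  let ?s = "switch (initial A) p P \<rho> w"
  have init: "initial A \<in> states A" using A by (auto simp: wf_automaton_def)
  have pol: "p q (w n) \<in> transitions A \<and> src (p q (w n)) = q \<and> letter (p q (w n)) = w n"
    if "q \<in> states A" for q n
    using p w that by (auto simp: is_policy_def words_def)
  have t: "?s n \<in> transitions A \<and> letter (?s n) = w n" for n
  proof (induction n)
    case 0
    then show ?case using pol[OF init] \<rho>[of 0] by (auto simp: is_run_def)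
  next
    case (Suc n)
    then show ?case
      using pol[of "tgt (?s n)" "Suc n"] tgt_states[OF A, of "?s n"] \<rho>[of "Suc n"]
      by (auto simp: is_run_def)
  qed
  have "src (?s 0) = initial A"
    using pol[OF init] \<rho>[of 0] by (auto simp: is_run_def)
  moreover have "tgt (?s n) = src (?s (Suc n))" for n
  proof (cases "P (Suc n)")
    case True
    then show ?thesis using pol[of "tgt (?s n)"] tgt_states[OF A, of "?s n"] t[of n] by auto
  next
    case False
    then have "\<not> P n" using P by blast
    then show ?thesis using False \<rho>[OF False] by (simp add: switch_before is_run_def)
  qed
  ultimately show ?thesis using t by (simp add: is_run_def)
qed

lemma switch_after:
  assumes "is_run A w (switch (initial A) p P \<rho> w)" "P n"
  shows "switch (initial A) p P \<rho> w n = p (src (switch (initial A) p P \<rho> w n)) (w n)"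
proof (cases n)
  case 0
  with assms show ?thesis using run_initial[OF assms(1)] by simp
next
  case (Suc k)
  with assms show ?thesis using run_step[OF assms(1), of k] by simp
qed

lemma exists_policy:
  assumes "wf_automaton A"
    and "\<And>q a. q \<in> states A \<Longrightarrow> a \<in> alphabet A \<Longrightarrow> \<exists>(x, q')\<in>delta A q a. R q a x q'"
  shows "\<exists>p. is_policy A p \<and>
    (\<forall>q\<in>states A. \<forall>a\<in>alphabet A. R q a (weight (p q a)) (tgt (p q a)))"
proof -
  have "\<forall>q a. \<exists>t. q \<in> states A \<longrightarrow> a \<in> alphabet A \<longrightarrow>
      t \<in> transitions A \<and> src t = q \<and> letter t = a \<and> R q a (weight t) (tgt t)"
  proof (intro allI)
    fix q a
    show "\<exists>t. q \<in> states A \<longrightarrow> a \<in> alphabet A \<longrightarrow>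
      t \<in> transitions A \<and> src t = q \<and> letter t = a \<and> R q a (weight t) (tgt t)"
    proof (cases "q \<in> states A \<and> a \<in> alphabet A")
      case True
      then obtain x q' where "(x, q') \<in> delta A q a" "R q a x q'" using assms(2) by blast
      then show ?thesis
        using True by (intro exI[of _ "Transition q a x q'"]) (auto simp: transitions_def)
    qed auto
  qed
  then obtain p where "\<forall>q a. q \<in> states A \<longrightarrow> a \<in> alphabet A \<longrightarrow>
      p q a \<in> transitions A \<and> src (p q a) = q \<and> letter (p q a) = a
      \<and> R q a (weight (p q a)) (tgt (p q a))"
    by metis
  then show ?thesis unfolding is_policy_def by blast
qed

lemma ex_policy:
  assumes "wf_automaton A"
  shows "\<exists>p. is_policy A p"
proof -
  have "\<exists>(x, q')\<in>delta A q a. True" if "q \<in> states A" "a \<in> alphabet A" for q a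
    using assms that by (fastforce simp: wf_automaton_def)
  then show ?thesis using exists_policy[OF assms, of "\<lambda>_ _ _ _. True"] by blast
qed

section \<open>Forcing a weight\<close>

lemma mono_forcing: "mono (forcing A m)"
proof (rule mono_iff_le_Suc[THEN iffD2], rule allI)
  fix k
  show "forcing A m k \<subseteq> forcing A m (Suc k)"
    by (induction k) (auto, fastforce)
qed

text \<open>If every letter had a good answer, each would use some stage; as the alphabet is finite,
  one stage bounds them all, and \<open>q\<close> would lie in the next.\<close>

lemma not_forcing:
  assumes A: "wf_automaton A" and q: "q \<in> states A" and F: "q \<notin> (\<Union>k. forcing A m k)"
  shows "\<exists>a\<in>alphabet A. \<forall>(x, q')\<in>delta A q a. x < m \<and> q' \<notin> (\<Union>k. forcing A m k)"
proof (rule ccontr)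
  assume "\<not> ?thesis"
  then have "\<forall>a\<in>alphabet A. \<exists>k. \<exists>(x, q')\<in>delta A q a. m \<le> x \<or> q' \<in> forcing A m k"
    by (fastforce simp: not_less)
  then obtain K where K: "\<And>a. a \<in> alphabet A \<Longrightarrow>
      \<exists>(x, q')\<in>delta A q a. m \<le> x \<or> q' \<in> forcing A m (K a)"
    by metis
  have fin: "finite (alphabet A)" using A by (simp add: wf_automaton_def)
  have "forcing A m (K a) \<subseteq> forcing A m (Max (K ` alphabet A))" if "a \<in> alphabet A" for a
    using that fin by (intro monoD[OF mono_forcing]) auto
  then have "q \<in> forcing A m (Suc (Max (K ` alphabet A)))"
    using K q by fastforce
  with F show False by blast
qed

text \<open>The move is chosen for the least stage containing \<open>q\<close>; since stages
  increase, it serves every larger stage, so one policy works for all \<open>k\<close>.\<close>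

lemma forcing_policy:
  assumes A: "wf_automaton A"
  shows "\<exists>p. is_policy A p \<and> (\<forall>a\<in>alphabet A. \<forall>k. \<forall>q\<in>forcing A m (Suc k).
    m \<le> weight (p q a) \<or> tgt (p q a) \<in> forcing A m k)"
proof -
  have "\<exists>(x, q')\<in>delta A q a. \<forall>k. q \<in> forcing A m (Suc k) \<longrightarrow> m \<le> x \<or> q' \<in> forcing A m k"
    if q: "q \<in> states A" and a: "a \<in> alphabet A" for q a
  proof (cases "\<exists>k. q \<in> forcing A m (Suc k)")
    case True
    define k where "k = (LEAST k. q \<in> forcing A m (Suc k))"
    have "q \<in> forcing A m (Suc k)" using True unfolding k_def by (rule LeastI_ex)
    then obtain x q' where x: "(x, q') \<in> delta A q a" "m \<le> x \<or> q' \<in> forcing A m k"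
      using a by auto
    have "m \<le> x \<or> q' \<in> forcing A m l" if "q \<in> forcing A m (Suc l)" for l
    proof -
      have "k \<le> l" using that unfolding k_def by (rule Least_le)
      then have "forcing A m k \<subseteq> forcing A m l" by (rule monoD[OF mono_forcing])
      then show ?thesis using x(2) by auto
    qed
    with x(1) show ?thesis by blast
  next
    case False
    have "delta A q a \<noteq> {}" using A q a by (simp add: wf_automaton_def)
    then obtain t where "t \<in> delta A q a" by blast
    with False show ?thesis by (intro bexI[of _ t]) (simp_all add: split_beta del: forcing.simps)
  qed
  from exists_policy[OF A this] obtain p where "is_policy A p"
    "\<forall>q\<in>states A. \<forall>a\<in>alphabet A. \<forall>k. q \<in> forcing A m (Suc k) \<longrightarrow>
       m \<le> weight (p q a) \<or> tgt (p q a) \<in> forcing A m k"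
    by blast
  moreover have "forcing A m (Suc k) \<subseteq> states A" for k by auto
  ultimately show ?thesis by blast
qed

text \<open>Until a weight at least \<open>m\<close> is seen, the stage drops by one in each turn,
  and stage 0 is empty.\<close>

lemma forcing_policy_reaches:
  assumes \<rho>: "is_run A w \<rho>" and w: "w \<in> words A"
    and p: "\<forall>a\<in>alphabet A. \<forall>k. \<forall>q\<in>forcing A m (Suc k).
      m \<le> weight (p q a) \<or> tgt (p q a) \<in> forcing A m k"
    and follow: "\<And>n. N \<le> n \<Longrightarrow> \<rho> n = p (src (\<rho> n)) (w n)"
    and F: "src (\<rho> N) \<in> forcing A m k"
  shows "\<exists>n. m \<le> weight (\<rho> n)"
  using follow F
proof (induction k arbitrary: N)
  case (Suc k)
  have "m \<le> weight (\<rho> N) \<or> tgt (\<rho> N) \<in> forcing A m k"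
    using p Suc.prems(1)[of N] Suc.prems(2) w by (metis le_refl mem_Collect_eq words_def)
  then show ?case
    using Suc.IH[of "Suc N"] Suc.prems(1) run_step[OF \<rho>] by force
qed simp

section \<open>Tokens oblige Eve to keep up with them\<close>

text \<open>Adam refutes a violation by leading Eve through letters that keep her out of the forcing set,
  while all tokens follow the forcing policy.\<close>

lemma token_winning_reaches:
  fixes A :: "('q, 'a) automaton"
  assumes A: "wf_automaton A" and win: "token_winning A J \<Phi>" and w: "w \<in> words A"
    and T: "\<And>j. j \<in> J \<Longrightarrow> is_run A w (T j)" and j: "j \<in> J" and r: "reaches A m (T j) N"
  shows "reaches A m (\<Phi> w T) N"
proof (rule ccontr)
  assume neg: "\<not> reaches A m (\<Phi> w T) N"
  define F where "F = (\<Union>k. forcing A m k)"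
  have causal: "causal \<Phi>" by (rule token_winning_causal[OF win])
  obtain p where p: "is_policy A p" and pF: "\<forall>a\<in>alphabet A. \<forall>k. \<forall>q\<in>forcing A m (Suc k).
      m \<le> weight (p q a) \<or> tgt (p q a) \<in> forcing A m k"
    using forcing_policy[OF A] by blast
  \<comment> \<open>Adam's spoiling letter at each state: outside \<open>F\<close> it admits neither
    a weight at least \<open>m\<close> nor a move into \<open>F\<close>; elsewhere any letter is
    taken.\<close>
  obtain \<sigma> where \<sigma>: "\<And>q. \<sigma> q \<in> alphabet A"
    "\<And>q x q'. q \<in> states A \<Longrightarrow> q \<notin> F \<Longrightarrow> (x, q') \<in> delta A q (\<sigma> q) \<Longrightarrow> x < m \<and> q' \<notin> F"
  proof -
    have "\<exists>a\<in>alphabet A. q \<in> states A \<longrightarrow> q \<notin> F \<longrightarrow>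
        (\<forall>x q'. (x, q') \<in> delta A q a \<longrightarrow> x < m \<and> q' \<notin> F)" for q
    proof (cases "q \<in> states A \<and> q \<notin> F")
      case True
      then obtain a where "a \<in> alphabet A" "\<forall>(x, q')\<in>delta A q a. x < m \<and> q' \<notin> F"
        using not_forcing[OF A, of q m] unfolding F_def by blast
      then show ?thesis by (intro bexI[of _ a]) auto
    next
      case False
      have "alphabet A \<noteq> {}" using A by (simp add: wf_automaton_def)
      with False show ?thesis by blast
    qed
    then show ?thesis using that by metis
  qed
  \<comment> \<open>The tokens keep their first \<open>N\<close> moves and then play to force
    \<open>m\<close> on whatever word results.\<close>
  define T' where "T' = (\<lambda>w j. switch (initial A) p (\<lambda>n. N \<le> n) (T j) w)"
  \<comment> \<open>Adam keeps the letters before turn \<open>N\<close>, then spoils at Eve's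
    current state. That state comes from her answer to the earlier letters, so the new word is a
    fixpoint, which exists by causality.\<close>
  define H where "H = (\<lambda>w' n. if n < N then w n else
     \<sigma> (case n of 0 \<Rightarrow> initial A | Suc k \<Rightarrow> tgt (\<Phi> w' (T' w') k)))"
  have "H f n = H g n" if eq: "\<And>i. i < n \<Longrightarrow> f i = g i" for f g n
  proof (cases n)
    case (Suc k)
    have "\<Phi> f (T' f) k = \<Phi> g (T' g) k"
    proof (rule causalD[OF causal])
      show "T' f j i = T' g j i" if "i < k" for j i
        unfolding T'_def by (rule switch_cong) (use that eq Suc in auto)
    qed (use eq Suc in auto)
    then show ?thesis using Suc by (simp add: H_def)
  qed (simp add: H_def)
  then obtain w' where w': "\<And>n. w' n = H w' n" using causal_fixpoint by metis
  have before: "w' n = w n" if "n < N" for n using w'[of n] that by (simp add: H_def)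
  have words: "w' \<in> words A"
    unfolding words_def using w' w \<sigma>(1) by (auto simp: H_def words_def)
  define \<pi> where "\<pi> = \<Phi> w' (T' w')"
  have runT: "is_run A w' (T' w' j)" if "j \<in> J" for j
    unfolding T'_def by (rule is_run_switch[OF A p words, where w' = w]) (use T[OF that] before in auto)
  have run\<pi>: "is_run A w' \<pi>" unfolding \<pi>_def by (rule token_winning_run[OF win words])
  have run\<Phi>: "is_run A w (\<Phi> w T)" by (rule token_winning_run[OF win w])
  \<comment> \<open>Nothing that Eve sees before turn \<open>N\<close> has changed.\<close>
  have same: "\<pi> n = \<Phi> w T n" if "n < N" for n
    unfolding \<pi>_def
    by (rule causalD[OF causal])
      (use that before in \<open>auto simp: T'_def switch_before\<close>)
  have after: "w' n = \<sigma> (src (\<pi> n))" if "N \<le> n" for n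
    using w'[of n] that run_initial[OF run\<pi>] run_step[OF run\<pi>]
    by (cases n) (auto simp: H_def \<pi>_def)
  have below: "weight (\<pi> n) < m \<and> tgt (\<pi> n) \<notin> F" if "N \<le> n" "src (\<pi> n) \<notin> F" for n
  proof -
    have "(weight (\<pi> n), tgt (\<pi> n)) \<in> delta A (src (\<pi> n)) (\<sigma> (src (\<pi> n)))"
      using run_transition[OF run\<pi>, of n] run_letter[OF run\<pi>, of n] after[OF that(1)]
      by (simp add: transitions_def)
    then show ?thesis using \<sigma>(2) that(2) run_src_states[OF run\<pi>] by blast
  qed
  have out: "src (\<pi> n) \<notin> F" if "N \<le> n" for n
    using that
  proof (induction n rule: dec_induct)
    case base
    then show ?case
      using neg run_src_cong[OF run\<pi> run\<Phi> same] by (auto simp: reaches_def F_def)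
  next
    case (step n)
    then show ?case using below run_step[OF run\<pi>] by simp
  qed
  have low: "\<not> m \<le> weight (\<pi> n)" for n
  proof (cases "n < N")
    case True
    then show ?thesis using neg same by (auto simp: reaches_def)
  next
    case False
    then show ?thesis using below out by (simp add: not_le)
  qed
  \<comment> \<open>Token \<open>j\<close> still gets a weight at least \<open>m\<close>, from its
    unchanged past or by the forcing policy, while Eve never does.\<close>
  have "\<exists>n. m \<le> weight (T' w' j n)"
  proof (cases "\<exists>i<N. m \<le> weight (T j i)")
    case True
    then obtain i where "i < N" "m \<le> weight (T j i)" by auto
    then have "m \<le> weight (T' w' j i)" by (simp add: T'_def switch_before)
    then show ?thesis ..
  next
    case False
    have "src (T' w' j N) = src (T j N)"
      by (rule run_src_cong[OF runT[OF j] T[OF j]]) (simp add: T'_def switch_before)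
    then obtain k where "src (T' w' j N) \<in> forcing A m k"
      using False r by (auto simp: reaches_def)
    moreover have "T' w' j n = p (src (T' w' j n)) (w' n)" if "N \<le> n" for n
      unfolding T'_def by (rule switch_after) (use that runT[OF j] in \<open>auto simp: T'_def\<close>)
    ultimately show ?thesis
      using forcing_policy_reaches[OF runT[OF j] words pF, of N k] by blast
  qed
  then have "ereal (of_rat m) \<le> run_value Sup_val (T' w' j)"
    using le_run_value_iff[OF A runT[OF j]] by blast
  also have "\<dots> \<le> run_value Sup_val \<pi>"
    unfolding \<pi>_def by (rule token_winning_value[OF win words runT j])
  finally show False using le_run_value_iff[OF A run\<pi>] low by blast
qed

section \<open>From two tokens to finitely many\<close>

text \<open>The strategy \<open>s\<close> is known to move legally only against legal tokens.
  Replacing its illegal answers by moves of a policy makes Eve's run legal unconditionally.\<close>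

lemma token_winning_two:
  fixes A :: "('q, 'a) automaton"
  assumes A: "wf_automaton A" and s: "G2_winning Sup_val A s"
  shows "\<exists>\<Phi>. token_winning A (UNIV :: bool set) \<Phi>"
proof -
  obtain p where p: "is_policy A p" using ex_policy[OF A] by blast
  define hist where "hist = (\<lambda>(T :: bool \<Rightarrow> nat \<Rightarrow> ('q, 'a) transition) (f :: nat \<Rightarrow> ('q, 'a) transition) n.
      map (\<lambda>i. (f i, T True i, T False i)) [0..<n])"
  define cur where "cur = (\<lambda>(f :: nat \<Rightarrow> ('q, 'a) transition) n.
      case n of 0 \<Rightarrow> initial A | Suc k \<Rightarrow> tgt (f k))"
  define H where "H = (\<lambda>w T f n. let t = s (hist T f n) (w n) in
      if t \<in> transitions A \<and> src t = cur f n \<and> letter t = w n then t else p (cur f n) (w n))"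
  have H_cong: "H w T f n = H w' T' g n"
    if "w n = w' n" "\<And>j i. i < n \<Longrightarrow> T j i = T' j i" "\<And>i. i < n \<Longrightarrow> f i = g i" for w w' T T' f g n
  proof -
    have "hist T f n = hist T' g n" using that by (simp add: hist_def)
    moreover have "cur f n = cur g n" using that by (auto simp: cur_def split: nat.split)
    ultimately show ?thesis using that by (simp add: H_def Let_def)
  qed
  have "\<exists>f. \<forall>n. f n = H w T f n" for w T
    by (rule causal_fixpoint) (rule H_cong, auto)
  then obtain \<Phi> where \<Phi>: "\<And>w T n. \<Phi> w T n = H w T (\<Phi> w T) n" by metis
  have causal: "causal \<Phi>"
    unfolding causal_def
  proof (intro allI impI)
    fix w w' :: "nat \<Rightarrow> 'a" and T T' :: "bool \<Rightarrow> nat \<Rightarrow> ('q, 'a) transition" and n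
    assume "\<forall>i\<le>n. w i = w' i" "\<forall>j. \<forall>i<n. T j i = T' j i"
    then show "\<Phi> w T n = \<Phi> w' T' n"
    proof (induction n rule: less_induct)
      case (less n)
      have "H w T (\<Phi> w T) n = H w' T' (\<Phi> w' T') n"
        by (rule H_cong) (use less in auto)
      then show ?case using \<Phi> by metis
    qed
  qed
  have run: "is_run A w (\<Phi> w T)" if w: "w \<in> words A" for w T
  proof -
    have legal: "H w T f n \<in> transitions A \<and> src (H w T f n) = cur f n \<and> letter (H w T f n) = w n"
      if "cur f n \<in> states A" for f n
      using p w that by (auto simp: H_def Let_def is_policy_def words_def)
    have cur: "cur (\<Phi> w T) n \<in> states A" for n
    proof (induction n)
      case 0
      then show ?case using A by (simp add: cur_def wf_automaton_def)
    next
      case (Suc n)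
      then show ?case using legal[OF Suc] \<Phi>[of w T n] tgt_states[OF A] by (simp add: cur_def)
    qed
    have *: "\<Phi> w T n \<in> transitions A \<and> src (\<Phi> w T n) = cur (\<Phi> w T) n \<and> letter (\<Phi> w T n) = w n" for n
      using legal[OF cur] \<Phi>[of w T n] by simp
    have "src (\<Phi> w T 0) = initial A" using *[of 0] by (simp add: cur_def)
    moreover have "src (\<Phi> w T (Suc n)) = tgt (\<Phi> w T n)" for n using *[of "Suc n"] by (simp add: cur_def)
    ultimately show ?thesis using * by (simp add: is_run_def)
  qed
  have "run_value Sup_val (T j) \<le> run_value Sup_val (\<Phi> w T)"
    if w: "w \<in> words A" and T: "\<And>j. is_run A w (T j)" for w T j
  proof -
    have "\<exists>\<pi>. \<forall>n. \<pi> n = s (hist T \<pi> n) (w n)"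
      by (rule causal_fixpoint) (auto simp: hist_def intro!: arg_cong2[where f = s])
    then obtain \<pi> where \<pi>: "\<And>n. \<pi> n = s (hist T \<pi> n) (w n)" by blast
    then have "G2_consistent s w \<pi> (T True) (T False)"
      unfolding G2_consistent_def hist_def by blast
    then have win: "is_run A w \<pi>"
      "run_value Sup_val \<pi> \<ge> max (run_value Sup_val (T True)) (run_value Sup_val (T False))"
      using s[unfolded G2_winning_def, rule_format, OF w] T by blast+
    \<comment> \<open>Against legal tokens the default move never occurs, so \<open>\<Phi>\<close>
      reproduces the play of \<open>s\<close>.\<close>
    have "\<Phi> w T n = \<pi> n" for n
    proof (induction n rule: less_induct)
      case (less n)
      have "\<pi> n \<in> transitions A \<and> src (\<pi> n) = cur \<pi> n \<and> letter (\<pi> n) = w n"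
        using win(1) by (cases n) (auto simp: is_run_def cur_def)
      then have "H w T \<pi> n = \<pi> n" using \<pi>[of n] by (simp add: H_def)
      moreover have "H w T (\<Phi> w T) n = H w T \<pi> n" by (rule H_cong) (use less in auto)
      ultimately show ?case using \<Phi> by metis
    qed
    then have "\<Phi> w T = \<pi>" by blast
    then show ?thesis using win(2) by (cases j) auto
  qed
  then show ?thesis using causal run unfolding token_winning_def by blast
qed

text \<open>Induction on the family: Eve's run against \<open>J\<close> and the new token
  \<open>j\<close> are the tokens of a two-token game, and her run there dominates both. With no
  tokens, following any policy suffices.\<close>

lemma token_winning_finite:
  fixes A :: "('q, 'a) automaton"
    and J :: "'i set"
  assumes A: "wf_automaton A" and s: "G2_winning Sup_val A s" and J: "finite J"
  shows "\<exists>\<Phi>. token_winning A J \<Phi>"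
  using J
proof (induction J)
  case empty
  obtain p where p: "is_policy A p" using ex_policy[OF A] by blast
  define \<Phi> :: "(nat \<Rightarrow> 'a) \<Rightarrow> ('i \<Rightarrow> nat \<Rightarrow> ('q, 'a) transition) \<Rightarrow> nat \<Rightarrow> ('q, 'a) transition"
    where "\<Phi> = (\<lambda>w T. switch (initial A) p (\<lambda>_. True) undefined w)"
  have "causal \<Phi>" unfolding causal_def \<Phi>_def by (auto intro: switch_cong)
  moreover have "is_run A w (\<Phi> w T)" if "w \<in> words A" for w T
    unfolding \<Phi>_def by (rule is_run_switch[OF A p that]) auto
  ultimately show ?case unfolding token_winning_def by blast
next
  case (insert j J)
  then obtain \<Phi> where \<Phi>: "token_winning A J \<Phi>" by blast
  obtain \<Psi> where \<Psi>: "token_winning A (UNIV :: bool set) \<Psi>" using token_winning_two[OF A s] by blast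
  define \<Omega> :: "(nat \<Rightarrow> 'a) \<Rightarrow> ('i \<Rightarrow> nat \<Rightarrow> ('q, 'a) transition) \<Rightarrow> nat \<Rightarrow> ('q, 'a) transition"
    where "\<Omega> = (\<lambda>w T. \<Psi> w (\<lambda>c. if c then \<Phi> w T else T j))"
  have "causal \<Omega>"
    unfolding causal_def
  proof (intro allI impI)
    fix w w' :: "nat \<Rightarrow> 'a" and T T' :: "'i \<Rightarrow> nat \<Rightarrow> ('q, 'a) transition" and n
    assume eq: "\<forall>i\<le>n. w i = w' i" "\<forall>j. \<forall>i<n. T j i = T' j i"
    have causal: "causal \<Phi>" "causal \<Psi>" using \<Phi> \<Psi> by (auto dest: token_winning_causal)
    \<comment> \<open>At turn \<open>n\<close>, \<open>\<Psi>\<close> sees the moves of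
      \<open>\<Phi>\<close> only before turn \<open>n\<close>, which keeps the composition
      causal.\<close>
    have "\<Phi> w T i = \<Phi> w' T' i" if "i < n" for i
      by (rule causalD[OF causal(1)]) (use eq that in auto)
    then show "\<Omega> w T n = \<Omega> w' T' n"
      unfolding \<Omega>_def by (intro causalD[OF causal(2)]) (use eq in auto)
  qed
  moreover have "is_run A w (\<Omega> w T)" if "w \<in> words A" for w T
    unfolding \<Omega>_def by (rule token_winning_run[OF \<Psi> that])
  moreover have "run_value Sup_val (T i) \<le> run_value Sup_val (\<Omega> w T)"
    if w: "w \<in> words A" and T: "\<forall>i\<in>insert j J. is_run A w (T i)" and i: "i \<in> insert j J" for w T i
  proof -
    let ?U = "\<lambda>c. if c then \<Phi> w T else T j"
    have "is_run A w (?U c)" for c using T token_winning_run[OF \<Phi> w] by simp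
    then have U: "run_value Sup_val (?U c) \<le> run_value Sup_val (\<Omega> w T)" for c
      unfolding \<Omega>_def by (intro token_winning_value[OF \<Psi> w, of ?U]) auto
    show ?thesis
    proof (cases "i = j")
      case True
      then show ?thesis using U[of False] by simp
    next
      case False
      then have "run_value Sup_val (T i) \<le> run_value Sup_val (\<Phi> w T)"
        using T i by (intro token_winning_value[OF \<Phi> w]) auto
      then show ?thesis using U[of True] by simp
    qed
  qed
  ultimately show ?case unfolding token_winning_def by blast
qed

section \<open>The token that copies Eve\<close>

text \<open>Runs that agree with Eve's for longer and longer are obtained from \<open>\<rho>\<close> by redirecting the
  copying token to the previous one and taking Eve's answer, which agrees with her original run
  for one more turn.\<close>

lemma copying_token_reaches:
  fixes A :: "('q, 'a) automaton"
  assumes A: "wf_automaton A" and win: "token_winning A J \<Phi>" and w: "w \<in> words A"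
    and T: "\<And>j. j \<in> J \<Longrightarrow> is_run A w (T j)" and j: "j \<in> J" and copy: "T j = \<Phi> w T"
    and \<rho>: "is_run A w \<rho>" and r: "reaches A m \<rho> N"
  shows "reaches A m (\<Phi> w T) N"
proof -
  have run: "is_run A w (\<Phi> w T')" for T' by (rule token_winning_run[OF win w])
  have "\<exists>\<rho>'. is_run A w \<rho>' \<and> (\<forall>n<i. \<rho>' n = \<Phi> w T n) \<and> reaches A m \<rho>' N" for i
  proof (induction i)
    case 0
    then show ?case using \<rho> r by auto
  next
    case (Suc i)
    then obtain \<rho>' where \<rho>': "is_run A w \<rho>'" "\<forall>n<i. \<rho>' n = \<Phi> w T n" "reaches A m \<rho>' N" by blast
    \<comment> \<open>Before turn \<open>i\<close> the redirected token still copies Eve, so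
      causality leaves her moves up to and including turn \<open>i\<close> unchanged.\<close>
    let ?T = "T(j := \<rho>')"
    have "reaches A m (\<Phi> w ?T) N"
      by (rule token_winning_reaches[OF A win w, where j = j]) (use T j \<rho>' in auto)
    moreover have "\<Phi> w ?T n = \<Phi> w T n" if "n < Suc i" for n
    proof -
      have causal: "causal \<Phi>" by (rule token_winning_causal[OF win])
      show ?thesis
        by (rule causalD[OF causal]) (use that \<rho>'(2) copy in auto)
    qed
    ultimately show ?case using run by blast
  qed
  \<comment> \<open>For \<open>i = N\<close> the run shares Eve's first \<open>N\<close> moves,
    hence the weights seen and the state before turn \<open>N\<close>.\<close>
  then obtain \<rho>' where \<rho>': "is_run A w \<rho>'" "\<forall>n<N. \<rho>' n = \<Phi> w T n" "reaches A m \<rho>' N" by blast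
  then show ?thesis
    using run_src_cong[OF \<rho>'(1) run[of T], of N] by (auto simp: reaches_def)
qed

section \<open>The equivalence of the two games\<close>

lemma G2_imp_history_deterministic:
  fixes A :: "('q, 'a) automaton"
  assumes A: "wf_automaton A" and s: "G2_winning Sup_val A s"
  shows "history_deterministic Sup_val A"
proof -
  define W where "W = weight ` transitions A"
  \<comment> \<open>\<open>None\<close> is the copying token and \<open>Some m\<close> the token of
    weight \<open>m\<close>.\<close>
  define J where "J = insert None (Some ` W)"
  have "finite J" using finite_weights[OF A] by (simp add: J_def W_def)
  then obtain \<Phi> where win: "token_winning A J \<Phi>" using token_winning_finite[OF A s] by blast
  then have causal: "causal \<Phi>" by (rule token_winning_causal)
  define F where "F = (\<lambda>m. \<Union>k. forcing A m k)"
  have "\<forall>m. \<exists>p. is_policy A p \<and> (\<forall>a\<in>alphabet A. \<forall>k. \<forall>q\<in>forcing A m (Suc k).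
      m \<le> weight (p q a) \<or> tgt (p q a) \<in> forcing A m k)"
    using forcing_policy[OF A] by blast
  then obtain p where p: "\<And>m. is_policy A (p m)"
    and pF: "\<And>m. \<forall>a\<in>alphabet A. \<forall>k. \<forall>q\<in>forcing A m (Suc k).
      m \<le> weight (p m q a) \<or> tgt (p m q a) \<in> forcing A m k"
    by metis
  \<comment> \<open>A past visit counts too, so that the switch to the forcing policy is
    irrevocable.\<close>
  define P where "P = (\<lambda>m \<pi> n. \<exists>i\<le>n::nat. src (\<pi> i :: ('q, 'a) transition) \<in> F m)"
  define tok where "tok = (\<lambda>w \<pi> j. case j of None \<Rightarrow> \<pi>
      | Some m \<Rightarrow> switch (initial A) (p m) (P m \<pi>) \<pi> w)"
  \<comment> \<open>Token moves of turn \<open>n\<close> depend on Eve's moves up to turn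
    \<open>n\<close>. This is not circular, since Eve reads only token moves of earlier
    turns.\<close>
  have tok_cong: "tok w \<pi> j n = tok w' \<pi>' j n"
    if eq: "\<And>i. i \<le> n \<Longrightarrow> w i = w' i" "\<And>i. i \<le> n \<Longrightarrow> \<pi> i = \<pi>' i" for w w' \<pi> \<pi>' j n
  proof (cases j)
    case (Some m)
    have "P m \<pi> i = P m \<pi>' i" if "i \<le> n" for i
      using eq(2) that by (auto simp: P_def)
    then show ?thesis
      using Some eq by (auto simp: tok_def intro: switch_cong)
  qed (use eq in \<open>simp add: tok_def\<close>)
  \<comment> \<open>Adam's past letters are read off Eve's transitions. Positions after the current
    one repeat its letter; by causality Eve's current move does not depend on them.\<close>
  define word where "word = (\<lambda>h (a :: 'a) i. if i < length h then letter (h ! i :: ('q, 'a) transition) else a)"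
  define strat where "strat = (\<lambda>h a. \<Phi> (word h a) (tok (word h a) (\<lambda>i. h ! i)) (length h))"
  have "is_run A w \<pi> \<and> word_value Sup_val A w \<le> run_value Sup_val \<pi>"
    if w: "w \<in> words A" and cons: "letter_consistent strat w \<pi>" for w \<pi>
  proof -
    define T where "T = tok w \<pi>"
    have run\<Phi>: "is_run A w (\<Phi> w T)" by (rule token_winning_run[OF win w])
    \<comment> \<open>The play is identified, turn by turn, with the answer of \<open>\<Phi>\<close>
      to tokens computed from the play itself.\<close>
    have "\<pi> n = \<Phi> w T n" for n
    proof (induction n rule: less_induct)
      case (less n)
      let ?h = "map \<pi> [0..<n]"
      have word: "word ?h (w n) i = w i" if "i \<le> n" for i
        using that less run_letter[OF run\<Phi>] by (auto simp: word_def)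
      have "\<pi> n = strat ?h (w n)" using cons by (simp add: letter_consistent_def)
      also have "\<dots> = \<Phi> w T n"
        unfolding strat_def length_map length_upt diff_zero
      proof (rule causalD[OF causal])
        show "tok (word ?h (w n)) (\<lambda>i. ?h ! i) j i = T j i" if "i < n" for j i
          unfolding T_def by (rule tok_cong) (use word that in auto)
      qed (use word in auto)
      finally show ?case .
    qed
    then have \<pi>: "\<pi> = \<Phi> w T" by blast
    with run\<Phi> have run: "is_run A w \<pi>" by simp
    have runT: "is_run A w (T j)" for j
    proof (cases j)
      case None
      then show ?thesis using run by (simp add: T_def tok_def)
    next
      case (Some m)
      have "is_run A w (switch (initial A) (p m) (P m \<pi>) \<pi> w)"
        by (rule is_run_switch[OF A p w, where w' = w]) (use run in \<open>auto simp: P_def intro: le_SucI\<close>)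
      then show ?thesis using Some by (simp add: T_def tok_def)
    qed
    have weight_le: "ereal (of_rat (weight (\<rho> n))) \<le> run_value Sup_val \<pi>" if \<rho>: "is_run A w \<rho>" for \<rho> n
    proof -
      define m where "m = weight (\<rho> n)"
      have mJ: "Some m \<in> J" using run_transition[OF \<rho>] by (simp add: J_def W_def m_def)
      have "reaches A m \<rho> (Suc n)" by (auto simp: reaches_def m_def)
      moreover have "T None = \<Phi> w T" by (rule trans[OF _ \<pi>]) (simp add: T_def tok_def)
      ultimately have "reaches A m (\<Phi> w T) (Suc n)"
        using copying_token_reaches[OF A win w runT, where j = None and \<rho> = \<rho>] \<rho> by (simp add: J_def)
      then have "reaches A m \<pi> (Suc n)" using \<pi> by metis
      then consider "\<exists>i. m \<le> weight (\<pi> i)" | "src (\<pi> (Suc n)) \<in> F m"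
        by (auto simp: reaches_def F_def)
      then show ?thesis
      proof cases
        case 1
        then show ?thesis using le_run_value_iff[OF A run] by (simp add: m_def)
      next
        case 2
        \<comment> \<open>At the first visit \<open>N\<close> to \<open>F m\<close> the token of
          \<open>m\<close> stops copying and forces \<open>m\<close>; Eve's value is at least that
          of the token.\<close>
        define N where "N = (LEAST i. src (\<pi> i) \<in> F m)"
        have N: "src (\<pi> N) \<in> F m" using 2 unfolding N_def by (rule LeastI)
        have P: "P m \<pi> i \<longleftrightarrow> N \<le> i" for i
        proof
          assume "P m \<pi> i"
          then obtain l where "l \<le> i" "src (\<pi> l) \<in> F m" by (auto simp: P_def)
          from this(2) have "N \<le> l" unfolding N_def by (rule Least_le)
          with \<open>l \<le> i\<close> show "N \<le> i" by simp
        qed (use N in \<open>auto simp: P_def\<close>)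
        have T: "T (Some m) = switch (initial A) (p m) (P m \<pi>) \<pi> w" by (simp add: T_def tok_def)
        have "src (T (Some m) N) = src (\<pi> N)"
          by (rule run_src_cong[OF runT run]) (simp add: T switch_before P)
        with N obtain k where "src (T (Some m) N) \<in> forcing A m k" by (auto simp: F_def)
        moreover have "T (Some m) i = p m (src (T (Some m) i)) (w i)" if "N \<le> i" for i
          unfolding T by (rule switch_after) (use that runT[of "Some m"] T P in auto)
        ultimately have "\<exists>i. m \<le> weight (T (Some m) i)"
          using forcing_policy_reaches[OF runT w pF] by blast
        then have "ereal (of_rat m) \<le> run_value Sup_val (T (Some m))"
          using le_run_value_iff[OF A runT] by blast
        also have "\<dots> \<le> run_value Sup_val \<pi>"
          unfolding \<pi> by (rule token_winning_value[OF win w runT mJ])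
        finally show ?thesis by (simp add: m_def)
      qed
    qed
    have "run_value Sup_val \<rho> \<le> run_value Sup_val \<pi>" if "is_run A w \<rho>" for \<rho>
      using weight_le[OF that] unfolding run_value_def[of _ \<rho>] Sup_val_def by (intro SUP_least)
    then have "word_value Sup_val A w \<le> run_value Sup_val \<pi>"
      unfolding word_value_def by (intro SUP_least) auto
    with run show ?thesis by blast
  qed
  then show ?thesis unfolding history_deterministic_def letter_winning_def by blast
qed

text \<open>Eve ignores the tokens: their runs belong to the supremum that her letter-game strategy
  already matches, whatever the value function.\<close>

lemma history_deterministic_imp_G2:
  assumes "history_deterministic Val A"
  shows "Eve_wins_G2 Val A"
proof -
  obtain s where s: "letter_winning Val A s"
    using assms by (auto simp: history_deterministic_def)
  have "G2_winning Val A (\<lambda>h. s (map fst h))"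
    unfolding G2_winning_def
  proof (intro ballI allI impI, elim conjE)
    fix w \<pi> \<pi>1 \<pi>2
    assume w: "w \<in> words A" and runs: "is_run A w \<pi>1" "is_run A w \<pi>2"
      and cons: "G2_consistent (\<lambda>h. s (map fst h)) w \<pi> \<pi>1 \<pi>2"
    from cons have "letter_consistent s w \<pi>"
      unfolding G2_consistent_def letter_consistent_def map_map comp_def fst_conv .
    then have "is_run A w \<pi>" "word_value Val A w \<le> run_value Val \<pi>"
      using s w by (auto simp: letter_winning_def)
    moreover have "run_value Val \<rho> \<le> word_value Val A w" if "is_run A w \<rho>" for \<rho>
      unfolding word_value_def using that by (intro SUP_upper) auto
    ultimately show "is_run A w \<pi> \<and> max (run_value Val \<pi>1) (run_value Val \<pi>2) \<le> run_value Val \<pi>"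
      using runs by (meson max.boundedI order_trans)
  qed
  then show ?thesis by (auto simp: Eve_wins_G2_def)
qed

theorem corollary5p7:
  fixes A :: "('q, 'a) automaton"
  assumes "wf_automaton A"
  shows "history_deterministic Sup_val A \<longleftrightarrow> Eve_wins_G2 Sup_val A"
  using G2_imp_history_deterministic[OF assms] history_deterministic_imp_G2
  by (auto simp: Eve_wins_G2_def)

end
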